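(* Let $M$ be a split matroid on ground set $S$ such that $S$ can be partitioned into two bases of $M$. Then $M$ is equitable, that is, for every set $X\subseteq S$ there exists a basis $B$ of $M$ such that $S-B$ is also a basis of $M$ and $\lfloor |X|/2\rfloor\le |B\cap X|\le \lceil |X|/2\rceil$.
   Context: All matroids are on finite ground sets; $X-Y$ denotes set difference. Elementary split matroid: let $S$ be a finite set, $r,r_1,\dots,r_q$ ($q\ge 0$) non-negative integers with $|S|\ge r$, and $H_1,\dots,H_q\subseteq S$ subsets such that $|H_i\cap H_j|\le r_i+r_j-r$ for all $1\le i<j\le q$, and $|S-H_i|+r_i\ge r$ for all $i$. Then $\{X\subseteq S : |X|\le r,\ |X\cap H_i|\le r_i \text{ for } 1\le i\le q\}$ is the family of independent sets of a rank-$r$ matroid on $S$; matroids arising this way are called elementary split matroids. Split matroid: a matroid is a split matroid if at most one of its connected components is a non-uniform matroid, and this component, if it exists, is an elementary split matroid (all other components being uniform matroids). *)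

theory Defs
  imports Complex_Main
begin

text \<open>
  A matroid is given by its finite ground set \<open>S\<close> and its family \<open>\<I>\<close> of independent sets.
\<close>

locale matroid =
  fixes S :: "'a set" and \<I> :: "'a set set"
  assumes finite_ground: "finite S"
    and indep_subset_ground: "X \<in> \<I> \<Longrightarrow> X \<subseteq> S"
    and empty_indep: "{} \<in> \<I>"
    and indep_subset: "X \<in> \<I> \<Longrightarrow> Y \<subseteq> X \<Longrightarrow> Y \<in> \<I>"
    and augment: "X \<in> \<I> \<Longrightarrow> Y \<in> \<I> \<Longrightarrow> card X < card Y \<Longrightarrow> \<exists>y\<in>Y - X. insert y X \<in> \<I>"

definition basis :: "'a set set \<Rightarrow> 'a set \<Rightarrow> bool" where
  "basis \<I> B \<longleftrightarrow> B \<in> \<I> \<and> (\<forall>X\<in>\<I>. B \<subseteq> X \<longrightarrow> X = B)"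

definition circuit :: "'a set \<Rightarrow> 'a set set \<Rightarrow> 'a set \<Rightarrow> bool" where
  "circuit S \<I> C \<longleftrightarrow> C \<subseteq> S \<and> C \<notin> \<I> \<and> (\<forall>D. D \<subset> C \<longrightarrow> D \<in> \<I>)"

definition restriction :: "'a set set \<Rightarrow> 'a set \<Rightarrow> 'a set set" where
  "restriction \<I> C = {X \<in> \<I>. X \<subseteq> C}"

text \<open>
  Two elements lie in the same connected component iff they are equal or lie on a common
  circuit; for a matroid this is an equivalence relation on the ground set. In particular, each
  loop and each coloop forms a component by itself. Members of \<open>components S \<I>\<close> are the ground
  sets of the components; the component itself is the restriction to this set.
\<close>

definition conn_rel :: "'a set \<Rightarrow> 'a set set \<Rightarrow> ('a \<times> 'a) set" where
  "conn_rel S \<I> = {(x, y). x \<in> S \<and> y \<in> S \<and> (x = y \<or> (\<exists>C. circuit S \<I> C \<and> x \<in> C \<and> y \<in> C))}"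

definition components :: "'a set \<Rightarrow> 'a set set \<Rightarrow> 'a set set" where
  "components S \<I> = S // conn_rel S \<I>"

definition uniform_matroid :: "'a set \<Rightarrow> 'a set set \<Rightarrow> bool" where
  "uniform_matroid S \<I> \<longleftrightarrow>
     finite S \<and> (\<exists>k \<le> card S. \<I> = {X. X \<subseteq> S \<and> card X \<le> k})"

text \<open>The bound \<open>r\<^sub>i + r\<^sub>j - r\<close> below is taken in the integers, where it may be negative.\<close>

definition elementary_split_matroid :: "'a set \<Rightarrow> 'a set set \<Rightarrow> bool" where
  "elementary_split_matroid S \<I> \<longleftrightarrow> finite S \<and>
     (\<exists>(q :: nat) (r :: nat) (rs :: nat \<Rightarrow> nat) (H :: nat \<Rightarrow> 'a set).
        r \<le> card S \<and>
        (\<forall>i\<in>{1..q}. H i \<subseteq> S) \<and>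
        (\<forall>i\<in>{1..q}. \<forall>j\<in>{1..q}. i < j \<longrightarrow>
           int (card (H i \<inter> H j)) \<le> int (rs i) + int (rs j) - int r) \<and>
        (\<forall>i\<in>{1..q}. r \<le> card (S - H i) + rs i) \<and>
        \<I> = {X. X \<subseteq> S \<and> card X \<le> r \<and> (\<forall>i\<in>{1..q}. card (X \<inter> H i) \<le> rs i)})"

definition split_matroid :: "'a set \<Rightarrow> 'a set set \<Rightarrow> bool" where
  "split_matroid S \<I> \<longleftrightarrow> matroid S \<I> \<and>
     card {C \<in> components S \<I>. \<not> uniform_matroid C (restriction \<I> C)} \<le> 1 \<and>
     (\<forall>C\<in>components S \<I>. \<not> uniform_matroid C (restriction \<I> C) \<longrightarrow>
        elementary_split_matroid C (restriction \<I> C))"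

definition equitable_matroid :: "'a set \<Rightarrow> 'a set set \<Rightarrow> bool" where
  "equitable_matroid S \<I> \<longleftrightarrow>
     (\<forall>X. X \<subseteq> S \<longrightarrow>
        (\<exists>B. basis \<I> B \<and> basis \<I> (S - B) \<and>
             \<lfloor>real (card X) / 2\<rfloor> \<le> int (card (B \<inter> X)) \<and>
             int (card (B \<inter> X)) \<le> \<lceil>real (card X) / 2\<rceil>))"

end

theory Submission
  imports Defs
begin

text \<open>
  Call a pair of complementary bases \<open>B\<close>, \<open>B' = S - B\<close> balanced on \<open>X\<close> if \<open>card (B \<inter> X)\<close> and
  \<open>card (B' \<inter> X)\<close> differ by at most one; equitability says that every \<open>X\<close> has a balanced pair.
  The proof is a descent: from a pair with \<open>card (B' \<inter> X) < card (B \<inter> X)\<close> one reaches a pair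
  \<open>C\<close>, \<open>C'\<close> with \<open>card (C \<inter> X) = card (B \<inter> X) - 1\<close> (\<open>descent_from_components\<close>). Started at
  a pair with \<open>card (B' \<inter> X) + 2 \<le> card (B \<inter> X)\<close>, such a step gives
  \<open>card (C' \<inter> X) \<le> card (C \<inter> X)\<close>, and repeating it ends at a balanced pair.

  A matroid is the direct sum of its connected components, so bases may be changed in a single
  component, and an excess of \<open>B\<close> over \<open>B'\<close> on \<open>X\<close> is already present in some component. There
  the matroid is elementary split: uniform matroids are the case without any sets \<open>H i\<close>.

  The bases of an elementary split matroid of parameters \<open>r\<close>, \<open>H i\<close>, \<open>rs i\<close> are the sets of size
  \<open>r\<close> that meet each \<open>H i\<close> in at most \<open>rs i\<close> elements (\<open>card_maximal_elementary_split\<close>), so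
  everything becomes a question about partitions of a set into two parts of size \<open>r\<close> obeying
  these bounds. If the excess is one, the parts are swapped. Otherwise one looks for \<open>e \<in> B \<inter> X\<close>
  and \<open>f \<in> B' - X\<close> to be exchanged. The only obstacles are sets \<open>H i\<close> that are tight, meaning
  that their bound is attained by \<open>B\<close> or by \<open>B'\<close>. By \<open>slack_bound\<close>, two sets tight for \<open>B\<close>
  cover \<open>B\<close> and have no common element in \<open>B'\<close>. Hence each element of \<open>B\<close> avoids at most one
  set tight for \<open>B\<close>, and each element of \<open>B'\<close> lies in at most one of them; the same holds with
  the parts interchanged.

  Suppose now that every such pair is blocked. Counting rules out that few tight sets are
  responsible (\<open>no_blocking_by_one\<close>, \<open>no_blocking_by_two\<close>). What remains is a rigid pattern of two
  sets tight for \<open>B\<close> and two tight for \<open>B'\<close> (\<open>obtain_blocking_square\<close>). In it no single exchange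
  works, but exchanging two elements of each part at once does, one of the four being a common
  element of two sets tight for the same part (\<open>double_exchange\<close>, \<open>unblock\<close>).
\<close>

section \<open>Exchanging elements between two parts\<close>

lemma card_exchange:
  assumes "finite B" "U \<subseteq> B" "V \<inter> B = {}" "finite V"
  shows "card ((B - U \<union> V) \<inter> Z) + card (U \<inter> Z) = card (B \<inter> Z) + card (V \<inter> Z)"
proof -
  have "(B - U \<union> V) \<inter> Z = (B \<inter> Z - U \<inter> Z) \<union> (V \<inter> Z)" by blast
  moreover have "card ((B \<inter> Z - U \<inter> Z) \<union> (V \<inter> Z)) = card (B \<inter> Z - U \<inter> Z) + card (V \<inter> Z)"
    using assms by (intro card_Un_disjoint) auto
  moreover have "card (B \<inter> Z - U \<inter> Z) = card (B \<inter> Z) - card (U \<inter> Z)"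
    using assms by (intro card_Diff_subset) (auto intro: finite_subset)
  moreover have "card (U \<inter> Z) \<le> card (B \<inter> Z)"
    using assms by (intro card_mono) auto
  ultimately show ?thesis by simp
qed

text \<open>
  Two complementary bases of an elementary split matroid, described by the cardinality conditions
  alone. Both parts enter symmetrically, so that every fact about \<open>B\<close> can be reused for \<open>B'\<close>. The
  condition on \<open>card (H i \<inter> H j)\<close> is written additively to avoid truncated subtraction.
\<close>

locale split_partition =
  fixes B B' :: "'a set" and r :: nat and I :: "'i set" and rs :: "'i \<Rightarrow> nat"
    and H :: "'i \<Rightarrow> 'a set"
  assumes finite_parts: "finite B" "finite B'"
    and disjoint_parts: "B \<inter> B' = {}"
    and card_parts: "card B = r" "card B' = r"
    and H_subset: "i \<in> I \<Longrightarrow> H i \<subseteq> B \<union> B'"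
    and overlap: "i \<in> I \<Longrightarrow> j \<in> I \<Longrightarrow> i \<noteq> j \<Longrightarrow> card (H i \<inter> H j) + r \<le> rs i + rs j"
    and bound: "i \<in> I \<Longrightarrow> card (B \<inter> H i) \<le> rs i"
    and bound': "i \<in> I \<Longrightarrow> card (B' \<inter> H i) \<le> rs i"
begin

definition tight :: "'a set \<Rightarrow> 'i \<Rightarrow> bool" where
  "tight P i \<longleftrightarrow> i \<in> I \<and> card (P \<inter> H i) = rs i"

lemma swap_parts: "split_partition B' B r I rs H"
  using finite_parts disjoint_parts card_parts H_subset overlap bound bound'
  by unfold_locales auto

lemma exchange_sets:
  assumes "U \<subseteq> B" "V \<subseteq> B'" "card U = card V"
    and le: "\<And>i. i \<in> I \<Longrightarrow> card (B \<inter> H i) + card (V \<inter> H i) \<le> rs i + card (U \<inter> H i)"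
    and le': "\<And>i. i \<in> I \<Longrightarrow> card (B' \<inter> H i) + card (U \<inter> H i) \<le> rs i + card (V \<inter> H i)"
  shows "split_partition (B - U \<union> V) (B' - V \<union> U) r I rs H"
proof -
  have fin: "finite U" "finite V"
    using finite_subset[OF assms(1)] finite_subset[OF assms(2)] finite_parts by auto
  have disj: "V \<inter> B = {}" "U \<inter> B' = {}" using assms disjoint_parts by auto
  note ce = card_exchange[OF finite_parts(1) assms(1) disj(1) fin(2)]
    and ce' = card_exchange[OF finite_parts(2) assms(2) disj(2) fin(1)]
  show ?thesis
  proof
    show "finite (B - U \<union> V)" "finite (B' - V \<union> U)" using fin finite_parts by auto
    show "(B - U \<union> V) \<inter> (B' - V \<union> U) = {}" using assms(1,2) disjoint_parts by blast
    show "card (B - U \<union> V) = r" "card (B' - V \<union> U) = r"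
      using ce[of UNIV] ce'[of UNIV] card_parts assms(3) by simp_all
  next
    fix i assume i: "i \<in> I"
    show "H i \<subseteq> B - U \<union> V \<union> (B' - V \<union> U)" using H_subset[OF i] assms(1,2) by blast
    show "card ((B - U \<union> V) \<inter> H i) \<le> rs i" using ce[of "H i"] le[OF i] by linarith
    show "card ((B' - V \<union> U) \<inter> H i) \<le> rs i" using ce'[of "H i"] le'[OF i] by linarith
  qed (fact overlap)
qed

text \<open>
  Moving one element in and one out changes each intersection with \<open>H i\<close> by at most one, so only
  bounds attained already can be violated.
\<close>

lemma exchange_elements:
  assumes "e \<in> B" "f \<in> B'"
    and free: "\<And>i. tight B i \<Longrightarrow> f \<in> H i \<Longrightarrow> e \<in> H i"
    and free': "\<And>i. tight B' i \<Longrightarrow> e \<in> H i \<Longrightarrow> f \<in> H i"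
  shows "split_partition (B - {e} \<union> {f}) (B' - {f} \<union> {e}) r I rs H"
proof (rule exchange_sets)
  fix i assume i: "i \<in> I"
  show "card (B \<inter> H i) + card ({f} \<inter> H i) \<le> rs i + card ({e} \<inter> H i)"
    using bound[OF i] free[of i] i by (auto simp: tight_def Int_insert_left Suc_le_eq less_le)
  show "card (B' \<inter> H i) + card ({e} \<inter> H i) \<le> rs i + card ({f} \<inter> H i)"
    using bound'[OF i] free'[of i] i by (auto simp: tight_def Int_insert_left Suc_le_eq less_le)
qed (use assms in auto)

section \<open>Slack of two hyperedges\<close>

lemma slack_identity:
  assumes "i \<in> I" "j \<in> I"
  shows "card (B \<inter> H i) + card (B \<inter> H j) + card (B - (H i \<union> H j)) + card (B' \<inter> (H i \<inter> H j))
    = r + card (H i \<inter> H j)"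
proof -
  have "card (B \<inter> H i) + card (B \<inter> H j)
      = card (B \<inter> H i \<union> B \<inter> H j) + card (B \<inter> H i \<inter> (B \<inter> H j))"
    using finite_parts by (intro card_Un_Int) auto
  moreover have "card B = card ((B \<inter> H i \<union> B \<inter> H j) \<union> (B - (H i \<union> H j)))"
    by (rule arg_cong[where f = card]) blast
  moreover have "\<dots> = card (B \<inter> H i \<union> B \<inter> H j) + card (B - (H i \<union> H j))"
    using finite_parts by (intro card_Un_disjoint) auto
  moreover have "card (H i \<inter> H j) = card ((B \<inter> H i \<inter> (B \<inter> H j)) \<union> (B' \<inter> (H i \<inter> H j)))"
    using H_subset[OF assms(1)] by (intro arg_cong[where f = card]) blast
  moreover have "\<dots> = card (B \<inter> H i \<inter> (B \<inter> H j)) + card (B' \<inter> (H i \<inter> H j))"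
    using finite_parts disjoint_parts by (intro card_Un_disjoint) auto
  ultimately show ?thesis using card_parts by linarith
qed

text \<open>
  The fact behind all uses of the overlap condition. Read it as a bound, by the total slack of
  \<open>H i\<close> and \<open>H j\<close> in \<open>B\<close>, on the elements of \<open>B\<close> outside both sets and the elements of \<open>B'\<close>
  inside both.
\<close>

lemma slack_bound:
  assumes "i \<in> I" "j \<in> I" "i \<noteq> j"
  shows "card (B \<inter> H i) + card (B \<inter> H j) + card (B - (H i \<union> H j)) + card (B' \<inter> (H i \<inter> H j))
    \<le> rs i + rs j"
  using slack_identity[OF assms(1,2)] overlap[OF assms] by linarith

lemma tight_pair:
  assumes "tight B i" "tight B j" "i \<noteq> j"
  shows "B \<subseteq> H i \<union> H j" "B' \<inter> (H i \<inter> H j) = {}" "r + card (H i \<inter> H j) = rs i + rs j"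
proof -
  have "card (B - (H i \<union> H j)) + card (B' \<inter> (H i \<inter> H j)) = 0"
    using slack_bound[of i j] assms unfolding tight_def by linarith
  then show "B \<subseteq> H i \<union> H j" "B' \<inter> (H i \<inter> H j) = {}"
    using finite_parts by auto
  show "r + card (H i \<inter> H j) = rs i + rs j"
    using slack_identity[of i j] assms \<open>_ = 0\<close> unfolding tight_def by linarith
qed

lemma tight_avoided_unique:
  "tight B i \<Longrightarrow> tight B j \<Longrightarrow> x \<in> B \<Longrightarrow> x \<notin> H i \<Longrightarrow> x \<notin> H j \<Longrightarrow> i = j"
  using tight_pair(1) by blast

lemma tight_entered_unique:
  "tight B i \<Longrightarrow> tight B j \<Longrightarrow> y \<in> B' \<Longrightarrow> y \<in> H i \<Longrightarrow> y \<in> H j \<Longrightarrow> i = j"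
  using tight_pair(2) by blast

text \<open>
  A total slack of at most one leaves room for only one of the two elements \<open>x\<close> and \<open>y\<close>. A
  double exchange can break a bound that is not attained only if it was one away from being
  attained and both new elements count towards it, so this lemma controls the sets that are not
  tight.
\<close>

lemma tight_with_almost_tight:
  assumes "tight B i" "k \<in> I" "k \<noteq> i" "rs k \<le> Suc (card (B \<inter> H k))"
    and x: "x \<in> B" "x \<notin> H i" "x \<notin> H k" and y: "y \<in> B'" "y \<in> H i" "y \<in> H k"
  shows False
proof -
  have "0 < card (B - (H i \<union> H k))" "0 < card (B' \<inter> (H i \<inter> H k))"
    using x y finite_parts by (auto simp: card_gt_0_iff)
  moreover have "i \<in> I" "card (B \<inter> H i) = rs i" using assms(1) by (auto simp: tight_def)
  ultimately show False using slack_bound[of i k] assms(2-4) by fastforce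
qed

section \<open>A double exchange\<close>

text \<open>
  The memberships of \<open>f1\<close> and \<open>f2\<close> in the four tight sets follow a square pattern. The element
  \<open>e0\<close> compensates for \<open>f1\<close> in \<open>H a\<close> and for \<open>f2\<close> in \<open>H c\<close>; \<open>f1\<close> compensates for \<open>e1\<close> in
  \<open>H a'\<close>, and \<open>f2\<close> for a possible \<open>e0\<close> in \<open>H c'\<close>. Every other set tight for \<open>B\<close> contains
  neither \<open>f1\<close> nor \<open>f2\<close>, and every other set tight for \<open>B'\<close> contains both.
\<close>

lemma double_exchange:
  assumes T: "tight B a" "tight B c" and T': "tight B' a'" "tight B' c'"
    and e0: "e0 \<in> B" "e0 \<in> H a" "e0 \<in> H c" "e0 \<notin> H a'"
    and e1: "e1 \<in> B" "e1 \<notin> H a" "e1 \<in> H a'" "e1 \<notin> H c'"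
    and f1: "f1 \<in> B'" "f1 \<in> H a" "f1 \<notin> H c" "f1 \<in> H a'" "f1 \<notin> H c'"
    and f2: "f2 \<in> B'" "f2 \<in> H c" "f2 \<notin> H a'" "f2 \<in> H c'"
  shows "split_partition (B - {e0, e1} \<union> {f1, f2}) (B' - {f1, f2} \<union> {e0, e1}) r I rs H"
proof (rule exchange_sets)
  interpret sw: split_partition B' B r I rs H by (fact swap_parts)
  have ne: "e0 \<noteq> e1" "f1 \<noteq> f2" using e0 e1 f1 f2 by auto
  show "{e0, e1} \<subseteq> B" "{f1, f2} \<subseteq> B'" "card {e0, e1} = card {f1, f2}"
    using e0 e1 f1 f2 ne by auto
  fix k assume k: "k \<in> I"
  show "card (B \<inter> H k) + card ({f1, f2} \<inter> H k) \<le> rs k + card ({e0, e1} \<inter> H k)"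
  proof (cases "tight B k")
    case True
    have "f1 \<in> H k \<Longrightarrow> k = a" "f2 \<in> H k \<Longrightarrow> k = c"
      using tight_entered_unique True T f1 f2 by blast+
    then show ?thesis using e0 f1 bound[OF k] ne
      by (auto simp: Int_insert_left)
  next
    case False
    then have lt: "card (B \<inter> H k) < rs k" using bound[OF k] k by (simp add: tight_def)
    show ?thesis
    proof (rule ccontr)
      assume "\<not> ?thesis"
      then have "f1 \<in> H k" "e0 \<notin> H k" "e1 \<notin> H k" "rs k \<le> Suc (card (B \<inter> H k))"
        using lt ne by (auto simp: Int_insert_left split: if_splits)
      then show False using tight_with_almost_tight[of a k e1 f1] T e0 e1 f1 k by blast
    qed
  qed
  show "card (B' \<inter> H k) + card ({e0, e1} \<inter> H k) \<le> rs k + card ({f1, f2} \<inter> H k)"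
  proof (cases "tight B' k")
    case True
    have "k = c' \<or> f1 \<in> H k" "k = a' \<or> f2 \<in> H k" "e1 \<in> H k \<Longrightarrow> k = a'"
      using sw.tight_avoided_unique sw.tight_entered_unique True T' e1 f1 f2 by blast+
    then show ?thesis using e0 e1 f1 f2 bound'[OF k] ne
      by (auto simp: Int_insert_left)
  next
    case False
    then have lt: "card (B' \<inter> H k) < rs k" using bound'[OF k] k by (simp add: tight_def)
    show ?thesis
    proof (rule ccontr)
      assume "\<not> ?thesis"
      then have "e1 \<in> H k" "f1 \<notin> H k" "f2 \<notin> H k" "rs k \<le> Suc (card (B' \<inter> H k))"
        using lt ne by (auto simp: Int_insert_left split: if_splits)
      then show False using sw.tight_with_almost_tight[of a' k f2 e1] T' f1 f2 e1 k by blast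
    qed
  qed
qed

end

section \<open>Blocked partitions\<close>

text \<open>
  The situation in which \<open>B\<close> has an excess of at least two and no exchange of an element of
  \<open>B \<inter> X\<close> with an element of \<open>B' - X\<close> is possible. It is preserved when the parts are interchanged and \<open>X\<close> is replaced by its complement,
  which halves the number of cases below.
\<close>

locale blocked_partition = split_partition +
  fixes X :: "'a set"
  assumes excess: "card (B' \<inter> X) + 2 \<le> card (B \<inter> X)"
    and blocked: "e \<in> B \<Longrightarrow> e \<in> X \<Longrightarrow> f \<in> B' \<Longrightarrow> f \<notin> X \<Longrightarrow>
      (\<exists>i. tight B i \<and> f \<in> H i \<and> e \<notin> H i) \<or> (\<exists>i. tight B' i \<and> e \<in> H i \<and> f \<notin> H i)"
begin

lemma card_split_X: "card (B \<inter> X) + card (B - X) = r" "card (B' \<inter> X) + card (B' - X) = r"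
  using finite_parts card_parts card_Int_Diff by metis+

lemma swap_blocked: "blocked_partition B' B r I rs H (- X)"
proof -
  interpret sw: split_partition B' B r I rs H by (fact swap_parts)
  show ?thesis
  proof
    show "card (B \<inter> - X) + 2 \<le> card (B' \<inter> - X)"
      using card_split_X excess by (simp add: Diff_eq)
    show "(\<exists>i. tight B' i \<and> f \<in> H i \<and> e \<notin> H i) \<or> (\<exists>i. tight B i \<and> e \<in> H i \<and> f \<notin> H i)"
      if "e \<in> B'" "e \<in> - X" "f \<in> B" "f \<notin> - X" for e f
      using blocked[of f e] that by auto
  qed
qed

lemma no_blocking_by_one:
  assumes "tight B i" "B \<inter> X \<inter> H i = {}" "B' - X \<subseteq> H i"
  shows False
proof -
  have "rs i = card (B \<inter> H i)" using assms(1) by (simp add: tight_def)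
  also have "\<dots> \<le> card (B - X)" using assms(2) finite_parts by (intro card_mono) auto
  also have "\<dots> < card (B' - X)" using card_split_X excess by linarith
  also have "\<dots> \<le> card (B' \<inter> H i)" using assms(3) finite_parts by (intro card_mono) auto
  also have "\<dots> \<le> rs i" using bound' assms(1) by (simp add: tight_def)
  finally show False by simp
qed

text \<open>
  This will exclude that one set tight for \<open>B\<close> and one tight for \<open>B'\<close> suffice to block everything.
  The set \<open>B \<inter> H i\<close> is covered by \<open>B - X\<close> and the overlap of the two sets, while \<open>B' \<inter> H j\<close> lies in
  \<open>X\<close>. So \<open>rs i + rs j\<close> exceeds the size of the overlap by at most
  \<open>card (B - X) + card (B' \<inter> X)\<close>, which the excess makes smaller than \<open>r\<close>,
  against the overlap condition.
\<close>

lemma no_blocking_by_two: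
  assumes T: "tight B i" "tight B' j" "i \<noteq> j"
    and A: "B \<inter> X \<inter> H i \<subseteq> H j" and F: "(B' - X) \<inter> H j = {}"
  shows False
proof -
  have I: "i \<in> I" "j \<in> I" using T by (auto simp: tight_def)
  have fin: "finite (H i \<inter> H j)" using H_subset[OF I(1)] finite_parts by (auto intro: finite_subset)
  have "card (B \<inter> H i) \<le> card ((B - X) \<union> (H i \<inter> H j))"
    using A fin finite_parts by (intro card_mono) auto
  also have "\<dots> \<le> card (B - X) + card (H i \<inter> H j)" by (rule card_Un_le)
  finally have 1: "rs i \<le> card (B - X) + card (H i \<inter> H j)" using T by (simp add: tight_def)
  have "card (B' \<inter> H j) \<le> card (B' \<inter> X)" using F finite_parts by (intro card_mono) auto
  then have 2: "rs j \<le> card (B' \<inter> X)" using T by (simp add: tight_def)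
  show False using 1 2 overlap[OF I T(3)] card_split_X excess by linarith
qed

lemma meets_X: "B \<inter> X \<noteq> {}" "B' - X \<noteq> {}"
proof -
  have "card (B \<inter> X) \<noteq> 0" "card (B' - X) \<noteq> 0" using excess card_split_X by linarith+
  then show "B \<inter> X \<noteq> {}" "B' - X \<noteq> {}" by (metis card.empty)+
qed

text \<open>
  If \<open>H i\<close> missed \<open>B \<inter> X\<close>, the elements of \<open>B' - X\<close> outside \<open>H i\<close> could only be blocked by sets
  tight for \<open>B'\<close>, and by uniqueness by the same one for all pairs; counting excludes this.
\<close>

lemma tight_meets_X:
  assumes "tight B i"
  shows "B \<inter> X \<inter> H i \<noteq> {}"
proof
  assume A: "B \<inter> X \<inter> H i = {}"
  interpret sw: blocked_partition B' B r I rs H "- X" by (fact swap_blocked)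
  obtain f where f: "f \<in> B'" "f \<notin> X" "f \<notin> H i"
    using no_blocking_by_one[OF assms A] by blast
  obtain e where e: "e \<in> B" "e \<in> X" using meets_X by blast
  have by_T': "\<exists>j. tight B' j \<and> e \<in> H j \<and> f \<notin> H j"
    if "e \<in> B" "e \<in> X" "f \<in> B'" "f \<notin> X" "f \<notin> H i" for e f
    using blocked[OF that(1-4)] tight_avoided_unique[OF assms _ that(1)] A that by blast
  obtain j where j: "tight B' j" "e \<in> H j" "f \<notin> H j" using by_T'[OF e f] by blast
  have "B \<inter> X \<subseteq> H j" using by_T' sw.tight_avoided_unique j f by blast
  moreover have "B' - X - H i \<subseteq> - H j" using by_T' sw.tight_entered_unique j e by blast
  ultimately show False
    using sw.no_blocking_by_two[of j i] assms j A e by blast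
qed

text \<open>
  If \<open>H i\<close> contained \<open>B' - X\<close>, it would be the only set tight for \<open>B\<close> that can block; the elements
  of \<open>B \<inter> X\<close> inside \<open>H i\<close> would all need one common set tight for \<open>B'\<close>; counting excludes this.
\<close>

lemma tight_omits_outside:
  assumes "tight B i"
  shows "\<not> B' - X \<subseteq> H i"
proof
  assume F: "B' - X \<subseteq> H i"
  interpret sw: blocked_partition B' B r I rs H "- X" by (fact swap_blocked)
  obtain e where e: "e \<in> B" "e \<in> X" "e \<in> H i" using tight_meets_X[OF assms] by blast
  obtain f where f: "f \<in> B'" "f \<notin> X" using meets_X by blast
  have by_T': "\<exists>j. tight B' j \<and> e \<in> H j \<and> f \<notin> H j"
    if "e \<in> B" "e \<in> X" "e \<in> H i" "f \<in> B'" "f \<notin> X" for e f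
    using blocked[of e f] tight_entered_unique[OF assms, of _ f] F that by blast
  obtain j where j: "tight B' j" "e \<in> H j" "f \<notin> H j" using by_T'[OF e f] by blast
  have "(B' - X) \<inter> H j = {}" using by_T' sw.tight_entered_unique j e by blast
  moreover have "B \<inter> X \<inter> H i \<subseteq> H j" using by_T' sw.tight_avoided_unique j f by blast
  ultimately show False using no_blocking_by_two[of i j] assms j F f by blast
qed

text \<open>
  Arranged in a square with the \<open>e\<close>'s at opposite corners, each side joins some \<open>e\<close> to some \<open>f\<close>
  and is labelled with the one tight set that blocks this pair: \<open>a\<close> blocks \<open>e1\<close>, \<open>f1\<close>; \<open>c\<close> blocks
  \<open>e2\<close>, \<open>f2\<close>; \<open>a'\<close> blocks \<open>e1\<close>, \<open>f2\<close>; \<open>c'\<close> blocks \<open>e2\<close>, \<open>f1\<close>.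
\<close>

definition blocking_square ::
    "'b \<Rightarrow> 'b \<Rightarrow> 'b \<Rightarrow> 'b \<Rightarrow> 'a \<Rightarrow> 'a \<Rightarrow> 'a \<Rightarrow> 'a \<Rightarrow> bool" where
  "blocking_square a c a' c' e1 e2 f1 f2 \<longleftrightarrow>
    tight B a \<and> tight B c \<and> tight B' a' \<and> tight B' c' \<and>
    {e1, e2} \<subseteq> B \<inter> X \<and> {f1, f2} \<subseteq> B' - X \<and>
    e1 \<notin> H a \<and> e1 \<in> H c \<and> e1 \<in> H a' \<and> e1 \<notin> H c' \<and>
    e2 \<in> H a \<and> e2 \<notin> H c \<and> e2 \<notin> H a' \<and> e2 \<in> H c' \<and>
    f1 \<in> H a \<and> f1 \<notin> H c \<and> f1 \<in> H a' \<and> f1 \<notin> H c' \<and>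
    f2 \<notin> H a \<and> f2 \<in> H c \<and> f2 \<notin> H a' \<and> f2 \<in> H c'"

text \<open>
  Fix any \<open>f1\<close>. At most one set tight for \<open>B\<close> and at most one tight for \<open>B'\<close> can block it, and
  neither blocks it from all of \<open>B \<inter> X\<close>; so both occur, which gives \<open>a\<close>, \<open>c'\<close>, \<open>e1\<close>, \<open>e2\<close>. The
  set \<open>H a\<close> does not contain all of \<open>B' - X\<close>; an element \<open>f2\<close> left out needs two further tight
  sets to be blocked from \<open>e1\<close> and \<open>e2\<close>.
\<close>

lemma obtain_blocking_square:
  obtains a c a' c' e1 e2 f1 f2 where "blocking_square a c a' c' e1 e2 f1 f2"
proof -
  interpret sw: blocked_partition B' B r I rs H "- X" by (fact swap_blocked)
  note uniq = tight_avoided_unique tight_entered_unique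
    sw.tight_avoided_unique sw.tight_entered_unique
  obtain f1 where f1: "f1 \<in> B'" "f1 \<notin> X" using meets_X by blast
  obtain e where e: "e \<in> B" "e \<in> X" using meets_X by blast
  obtain a c' e1 e2 where ac': "tight B a" "tight B' c'" "f1 \<in> H a" "f1 \<notin> H c'"
    and e1: "e1 \<in> B" "e1 \<in> X" "e1 \<notin> H a" "e1 \<notin> H c'"
    and e2: "e2 \<in> B" "e2 \<in> X" "e2 \<in> H a" "e2 \<in> H c'"
  proof -
    consider a where "tight B a" "f1 \<in> H a" | c' where "tight B' c'" "f1 \<notin> H c'"
      using blocked[OF e f1] by blast
    then show ?thesis
    proof cases
      case 1
      obtain e2 where e2: "e2 \<in> B" "e2 \<in> X" "e2 \<in> H a" using tight_meets_X 1 by blast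
      obtain c' where c': "tight B' c'" "e2 \<in> H c'" "f1 \<notin> H c'"
        using blocked[OF e2(1,2) f1] uniq(2)[OF 1(1) _ f1(1) 1(2)] e2(3) by blast
      obtain e1 where e1: "e1 \<in> B" "e1 \<in> X" "e1 \<notin> H c'"
        using sw.tight_omits_outside[OF c'(1)] by blast
      have "e1 \<notin> H a"
        using blocked[OF e1(1,2) f1] uniq(2)[OF 1(1) _ f1(1) 1(2)]
          uniq(3)[OF c'(1) _ f1(1) c'(3)] e1(3) by blast
      then show ?thesis using that 1 c' e1 e2 by blast
    next
      case 2
      obtain e1 where e1: "e1 \<in> B" "e1 \<in> X" "e1 \<notin> H c'"
        using sw.tight_omits_outside[OF 2(1)] by blast
      obtain a where a: "tight B a" "f1 \<in> H a" "e1 \<notin> H a"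
        using blocked[OF e1(1,2) f1] uniq(3)[OF 2(1) _ f1(1) 2(2)] e1(3) by blast
      obtain e2 where e2: "e2 \<in> B" "e2 \<in> X" "e2 \<in> H a" using tight_meets_X a by blast
      have "e2 \<in> H c'"
        using blocked[OF e2(1,2) f1] uniq(2)[OF a(1) _ f1(1) a(2)]
          uniq(3)[OF 2(1) _ f1(1) 2(2)] e2(3) by blast
      then show ?thesis using that 2 a e1 e2 by blast
    qed
  qed
  obtain f2 where f2: "f2 \<in> B'" "f2 \<notin> X" "f2 \<notin> H a"
    using tight_omits_outside[OF ac'(1)] by blast
  obtain a' where a': "tight B' a'" "e1 \<in> H a'" "f2 \<notin> H a'"
    using blocked[OF e1(1,2) f2(1,2)] uniq(1)[OF ac'(1) _ e1(1,3)] f2(3) by blast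
  have f2c': "f2 \<in> H c'" using uniq(3) a' ac' e1 f2 by blast
  obtain c where c: "tight B c" "f2 \<in> H c" "e2 \<notin> H c"
    using blocked[OF e2(1,2) f2(1,2)] uniq(4)[OF ac'(2) _ e2(1,4)] f2c' by blast
  have "e1 \<in> H c" using uniq(1) c ac' e1 e2 by blast
  moreover have "e2 \<notin> H a'" using uniq(4) a' ac' e1 e2 by blast
  moreover have "f1 \<notin> H c" using uniq(2) c ac' e2 f1 by blast
  moreover have "f1 \<in> H a'" using uniq(3) a' ac' e1 f1 by blast
  ultimately have "blocking_square a c a' c' e1 e2 f1 f2"
    unfolding blocking_square_def using ac' a' c e1 e2 f1 f2 f2c' by blast
  then show ?thesis by (rule that)
qed

text \<open>
  A common element \<open>e0\<close> of \<open>H a\<close> and \<open>H c\<close> must lie in \<open>B\<close>, as the two sets are tight for \<open>B\<close>.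
  It lies outside \<open>X\<close>: otherwise it would be blocked from \<open>f1\<close> and \<open>f2\<close> by \<open>c'\<close> and \<open>a'\<close>, and so
  would lie in both of these sets tight for \<open>B'\<close>. Thus the double exchange removes a single element
  of \<open>X\<close> from \<open>B\<close> and adds none. As \<open>e0\<close> misses \<open>H a'\<close> or \<open>H c'\<close>, either \<open>e1\<close> or \<open>e2\<close> can
  accompany it.
\<close>

lemma unblock_via_overlap:
  assumes sq: "blocking_square a c a' c' e1 e2 f1 f2" and ne: "H a \<inter> H c \<noteq> {}"
  shows "\<exists>C C'. split_partition C C' r I rs H \<and> C \<union> C' = B \<union> B' \<and>
    card (C \<inter> X) + 1 = card (B \<inter> X) \<and> card (C' \<inter> X) = card (B' \<inter> X) + 1"
proof -
  interpret sw: blocked_partition B' B r I rs H "- X" by (fact swap_blocked)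
  note sqD = sq[unfolded blocking_square_def]
  have ac: "a \<noteq> c" "a' \<noteq> c'" using sqD by auto
  obtain e0 where e0: "e0 \<in> H a" "e0 \<in> H c" using ne by blast
  have "e0 \<in> B \<union> B'" using H_subset[of a] sqD e0 by (auto simp: tight_def)
  then have e0B: "e0 \<in> B" using tight_pair(2)[of a c] sqD ac e0 by blast
  have e0a'c': "e0 \<notin> H a' \<or> e0 \<notin> H c'"
    using sw.tight_entered_unique[of a' c' e0] sqD ac e0B by blast
  have e0X: "e0 \<notin> X"
  proof
    assume "e0 \<in> X"
    then obtain j j' where j: "tight B' j" "e0 \<in> H j" "f1 \<notin> H j"
      and j': "tight B' j'" "e0 \<in> H j'" "f2 \<notin> H j'"
      using blocked[of e0 f1] blocked[of e0 f2] tight_entered_unique[of a _ f1]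
        tight_entered_unique[of c _ f2] sqD e0 e0B by blast
    have "j = c'" "j' = a'" using sw.tight_avoided_unique sqD j j' by blast+
    then show False using j j' e0a'c' by blast
  qed
  have result: ?thesis
    if e: "e \<in> B" "e \<in> X"
      and ex: "split_partition (B - {e0, e} \<union> {f1, f2}) (B' - {f1, f2} \<union> {e0, e}) r I rs H"
    for e
  proof (intro exI conjI)
    let ?C = "B - {e0, e} \<union> {f1, f2}" and ?C' = "B' - {f1, f2} \<union> {e0, e}"
    show "split_partition ?C ?C' r I rs H" by (fact ex)
    have sub: "{e0, e} \<subseteq> B" "{f1, f2} \<subseteq> B'" using e e0B sqD by auto
    then show "?C \<union> ?C' = B \<union> B'" by blast
    have X: "{e0, e} \<inter> X = {e}" "{f1, f2} \<inter> X = {}" using e e0X sqD by auto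
    have "card (?C \<inter> X) + card ({e0, e} \<inter> X) = card (B \<inter> X) + card ({f1, f2} \<inter> X)"
      using sub disjoint_parts finite_parts by (intro card_exchange) auto
    then show "card (?C \<inter> X) + 1 = card (B \<inter> X)" unfolding X by simp
    have "card (?C' \<inter> X) + card ({f1, f2} \<inter> X) = card (B' \<inter> X) + card ({e0, e} \<inter> X)"
      using sub disjoint_parts finite_parts by (intro card_exchange) auto
    then show "card (?C' \<inter> X) = card (B' \<inter> X) + 1" unfolding X by simp
  qed
  show ?thesis
  proof (cases "e0 \<in> H a'")
    case False
    then show ?thesis
      using double_exchange[of a c a' c' e0 e1 f1 f2] sqD e0 e0B by (intro result[of e1]) auto
  next
    case True
    have "split_partition (B - {e0, e2} \<union> {f2, f1}) (B' - {f2, f1} \<union> {e0, e2}) r I rs H"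
      using double_exchange[of c a c' a' e0 e2 f2 f1] sqD e0 e0B e0a'c' True by auto
    then show ?thesis using sqD by (intro result[of e2]) (auto simp: insert_commute)
  qed
qed

text \<open>
  Each corner of the square is a common element of a set tight for \<open>B\<close> and one tight for \<open>B'\<close>,
  which makes all four sums such as \<open>rs a + rs a'\<close> larger than \<open>r\<close>. Hence \<open>rs a + rs c\<close> or
  \<open>rs a' + rs c'\<close> is larger than \<open>r\<close> too, and the two sets in question, being tight for the same
  part, have a common element.
\<close>

lemma unblock:
  "\<exists>C C'. split_partition C C' r I rs H \<and> C \<union> C' = B \<union> B' \<and> card (C \<inter> X) + 1 = card (B \<inter> X)"
proof -
  interpret sw: blocked_partition B' B r I rs H "- X" by (fact swap_blocked)
  obtain a c a' c' e1 e2 f1 f2 where sq: "blocking_square a c a' c' e1 e2 f1 f2"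
    by (rule obtain_blocking_square)
  note sqD = sq[unfolded blocking_square_def]
  have sq': "sw.blocking_square c' a' a c f1 f2 e2 e1"
    using sqD unfolding sw.blocking_square_def by auto
  have I: "a \<in> I" "c \<in> I" "a' \<in> I" "c' \<in> I" using sqD by (auto simp: tight_def)
  have fin: "finite (H i)" if "i \<in> I" for i
    using H_subset[OF that] finite_parts by (auto intro: finite_subset)
  have "r + 1 \<le> rs i + rs j" if "i \<in> I" "j \<in> I" "i \<noteq> j" "x \<in> H i \<inter> H j" for i j x
  proof -
    have "0 < card (H i \<inter> H j)" using that fin by (auto simp: card_gt_0_iff)
    then show ?thesis using overlap[OF that(1-3)] by linarith
  qed
  from this[of a a' f1] this[of a c' e2] this[of c a' e1] this[of c c' f2]
  \<comment> \<open>Adding the four inequalities gives \<open>2 * (rs a + rs c + rs a' + rs c') \<ge> 4 * r + 4\<close>.\<close>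
  have "r < rs a + rs c \<or> r < rs a' + rs c'" using I sqD by fastforce
  moreover have "r + card (H a \<inter> H c) = rs a + rs c" "r + card (H a' \<inter> H c') = rs a' + rs c'"
    using tight_pair(3)[of a c] sw.tight_pair(3)[of a' c'] sqD by blast+
  ultimately have "card (H a \<inter> H c) \<noteq> 0 \<or> card (H a' \<inter> H c') \<noteq> 0" by linarith
  then consider "H a \<inter> H c \<noteq> {}" | "H c' \<inter> H a' \<noteq> {}" by (metis card.empty inf_commute)
  then show ?thesis
  proof cases
    case 1
    then show ?thesis using unblock_via_overlap[OF sq] by blast
  next
    case 2
    obtain C' C where C: "split_partition C' C r I rs H" "C' \<union> C = B' \<union> B"
      and card_C: "card (C \<inter> - X) = card (B \<inter> - X) + 1"
      using sw.unblock_via_overlap[OF sq' 2] by blast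
    interpret C: split_partition C' C r I rs H by (fact C(1))
    have "card (C \<inter> X) + card (C - X) = r"
      using C.finite_parts C.card_parts card_Int_Diff by metis
    then have "card (C \<inter> X) + 1 = card (B \<inter> X)"
      using card_C card_split_X by (simp add: Diff_eq)
    then show ?thesis using C.swap_parts C(2) by blast
  qed
qed

end

lemma (in split_partition) descent:
  assumes "card (B' \<inter> X) < card (B \<inter> X)"
  shows "\<exists>C C'. split_partition C C' r I rs H \<and> C \<union> C' = B \<union> B' \<and>
    card (C \<inter> X) + 1 = card (B \<inter> X)"
proof -
  consider "card (B \<inter> X) = card (B' \<inter> X) + 1"
    | e f where "e \<in> B" "e \<in> X" "f \<in> B'" "f \<notin> X"
        "\<And>i. tight B i \<Longrightarrow> f \<in> H i \<Longrightarrow> e \<in> H i" "\<And>i. tight B' i \<Longrightarrow> e \<in> H i \<Longrightarrow> f \<in> H i"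
    | "blocked_partition B B' r I rs H X"
  proof -
    have "blocked_partition B B' r I rs H X"
      if "card (B \<inter> X) \<noteq> card (B' \<inter> X) + 1"
        and "\<And>e f. e \<in> B \<Longrightarrow> e \<in> X \<Longrightarrow> f \<in> B' \<Longrightarrow> f \<notin> X \<Longrightarrow>
          (\<exists>i. tight B i \<and> f \<in> H i \<and> e \<notin> H i) \<or> (\<exists>i. tight B' i \<and> e \<in> H i \<and> f \<notin> H i)"
      using assms that by unfold_locales auto
    then show ?thesis using that by metis
  qed
  then show ?thesis
  proof cases
    case 1
    then show ?thesis using swap_parts by (intro exI[of _ B'] exI[of _ B]) auto
  next
    case 2
    have "card ((B - {e} \<union> {f}) \<inter> X) + card ({e} \<inter> X) = card (B \<inter> X) + card ({f} \<inter> X)"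
      using 2 disjoint_parts finite_parts by (intro card_exchange) auto
    then show ?thesis
      using exchange_elements[OF 2(1,3,5,6)] 2
      by (intro exI[of _ "B - {e} \<union> {f}"] exI[of _ "B' - {f} \<union> {e}"]) auto
  next
    case 3
    then show ?thesis by (rule blocked_partition.unblock)
  qed
qed

section \<open>Bases of elementary split matroids\<close>

lemma elementary_splitE:
  assumes "elementary_split_matroid E J"
  obtains q r rs H where "finite E" "r \<le> card E"
    "\<And>i. i \<in> {1..q} \<Longrightarrow> H i \<subseteq> E"
    "\<And>i j. i \<in> {1..q} \<Longrightarrow> j \<in> {1..q} \<Longrightarrow> i \<noteq> j \<Longrightarrow> card (H i \<inter> H j) + r \<le> rs i + rs j"
    "\<And>i. i \<in> {1..q} \<Longrightarrow> r \<le> card (E - H i) + rs i"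
    "J = {X. X \<subseteq> E \<and> card X \<le> r \<and> (\<forall>i\<in>{1..q::nat}. card (X \<inter> H i) \<le> rs i)}"
proof -
  obtain q r rs H where h: "finite E" "r \<le> card E" "\<forall>i\<in>{1..q}. H i \<subseteq> E"
    and o: "\<forall>i\<in>{1..q}. \<forall>j\<in>{1..q}. i < j \<longrightarrow>
           int (card (H i \<inter> H j)) \<le> int (rs i) + int (rs j) - int r"
    and h2: "\<forall>i\<in>{1..q}. r \<le> card (E - H i) + rs i"
    "J = {X. X \<subseteq> E \<and> card X \<le> r \<and> (\<forall>i\<in>{1..q::nat}. card (X \<inter> H i) \<le> rs i)}"
    using assms unfolding elementary_split_matroid_def by blast
  have lt: "card (H i \<inter> H j) + r \<le> rs i + rs j" if "i \<in> {1..q}" "j \<in> {1..q}" "i < j" for i j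
  proof -
    have "int (card (H i \<inter> H j)) \<le> int (rs i) + int (rs j) - int r" using o that by blast
    then show ?thesis by linarith
  qed
  have "card (H i \<inter> H j) + r \<le> rs i + rs j" if "i \<in> {1..q}" "j \<in> {1..q}" "i \<noteq> j" for i j
    using lt[of i j] lt[of j i] that by (cases "i < j") (auto simp: Int_commute add.commute)
  with h h2 that show ?thesis by blast
qed

text \<open>
  Suppose a maximal independent set \<open>B\<close> had fewer than \<open>r\<close> elements. By the overlap condition it
  attains at most one of the bounds, and each element outside \<open>B\<close> lies in a set whose bound is
  attained. So a single \<open>H i\<close> contains all of \<open>E - B\<close>; then \<open>B\<close> contains \<open>E - H i\<close> besides \<open>rs i\<close>
  elements of \<open>H i\<close>, and these are at least \<open>r\<close> together.
\<close>

lemma card_maximal_elementary_split: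
  fixes H :: "'i \<Rightarrow> 'a set"
  assumes fin: "finite E" and r: "r \<le> card E"
    and overlap: "\<And>i j. i \<in> I \<Longrightarrow> j \<in> I \<Longrightarrow> i \<noteq> j \<Longrightarrow> card (H i \<inter> H j) + r \<le> rs i + rs j"
    and rank: "\<And>i. i \<in> I \<Longrightarrow> r \<le> card (E - H i) + rs i"
    and J: "J = {X. X \<subseteq> E \<and> card X \<le> r \<and> (\<forall>i\<in>I. card (X \<inter> H i) \<le> rs i)}"
    and H: "\<And>i. i \<in> I \<Longrightarrow> H i \<subseteq> E"
    and B: "basis J B"
  shows "card B = r"
proof (rule ccontr)
  assume "card B \<noteq> r"
  have BJ: "B \<in> J" and max: "\<And>X. X \<in> J \<Longrightarrow> B \<subseteq> X \<Longrightarrow> X = B"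
    using B by (auto simp: basis_def)
  have small: "card B < r" and BE: "B \<subseteq> E" and bound: "\<And>i. i \<in> I \<Longrightarrow> card (B \<inter> H i) \<le> rs i"
    using BJ \<open>card B \<noteq> r\<close> by (auto simp: J)
  have finB: "finite B" using BE fin finite_subset by blast
  have tight: "\<exists>i\<in>I. x \<in> H i \<and> card (B \<inter> H i) = rs i" if "x \<in> E - B" for x
  proof (rule ccontr)
    assume neg: "\<not> ?thesis"
    have "card (insert x B \<inter> H i) \<le> rs i" if "i \<in> I" for i
      using neg bound[OF that] that \<open>x \<in> E - B\<close> finB
      by (auto simp: Int_insert_left card_insert_if Suc_le_eq less_le)
    then have "insert x B \<in> J"
      using small BE that finB by (auto simp: J card_insert_if)
    then show False using max that by blast
  qed
  have unique: "i = j" if "i \<in> I" "j \<in> I" "card (B \<inter> H i) = rs i" "card (B \<inter> H j) = rs j" for i j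
  proof (rule ccontr)
    assume "i \<noteq> j"
    have "card (B \<inter> H i) + card (B \<inter> H j)
        = card (B \<inter> H i \<union> B \<inter> H j) + card (B \<inter> H i \<inter> (B \<inter> H j))"
      using finB by (intro card_Un_Int) auto
    moreover have "card (B \<inter> H i \<union> B \<inter> H j) \<le> card B"
      using finB by (intro card_mono) auto
    moreover have "card (B \<inter> H i \<inter> (B \<inter> H j)) \<le> card (H i \<inter> H j)"
      using H[OF that(1)] fin by (intro card_mono) (auto intro: finite_subset)
    ultimately show False using overlap[OF that(1,2) \<open>i \<noteq> j\<close>] that small by linarith
  qed
  have "E - B \<noteq> {}"
    using small r BE by auto
  then obtain i where i: "i \<in> I" "card (B \<inter> H i) = rs i" using tight by blast
  have "E - B \<subseteq> H i" using tight unique i by blast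
  then have "card (E - H i) \<le> card (B - H i)" using finB by (intro card_mono) auto
  moreover have "card (B \<inter> H i) + card (B - H i) = card B"
    using finB by (metis card_Int_Diff)
  ultimately show False using rank[OF i(1)] i small by linarith
qed

lemma elementary_split_descent:
  assumes es: "elementary_split_matroid E J"
    and B: "basis J B" "basis J (E - B)" and less: "card ((E - B) \<inter> X) < card (B \<inter> X)"
  shows "\<exists>C\<subseteq>E. basis J C \<and> basis J (E - C) \<and> card (C \<inter> X) + 1 = card (B \<inter> X)"
proof -
  obtain q r rs H where fin: "finite E" and r: "r \<le> card E"
    and H: "\<And>i. i \<in> {1..q} \<Longrightarrow> H i \<subseteq> E"
    and overlap: "\<And>i j. i \<in> {1..q} \<Longrightarrow> j \<in> {1..q} \<Longrightarrow> i \<noteq> j \<Longrightarrow> card (H i \<inter> H j) + r \<le> rs i + rs j"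
    and rank: "\<And>i. i \<in> {1..q} \<Longrightarrow> r \<le> card (E - H i) + rs i"
    and J: "J = {X. X \<subseteq> E \<and> card X \<le> r \<and> (\<forall>i\<in>{1..q::nat}. card (X \<inter> H i) \<le> rs i)}"
    using es by (elim elementary_splitE) blast
  have BE: "B \<subseteq> E" using B by (auto simp: basis_def J)
  have card_r: "card D = r" if "basis J D" for D
    using card_maximal_elementary_split[OF fin r overlap rank J H that] .
  have basisI: "basis J D" if "D \<in> J" "card D = r" for D
    unfolding basis_def
  proof (intro conjI ballI impI)
    fix Y assume Y: "Y \<in> J" "D \<subseteq> Y"
    then have "finite Y" "card Y \<le> card D" using fin that by (auto simp: J intro: finite_subset)
    then show "Y = D" using card_seteq[of Y D] Y by simp
  qed (fact that)
  interpret split_partition B "E - B" r "{1..q}" rs H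
  proof
    show "finite B" "finite (E - B)" using BE fin finite_subset by auto
    show "card B = r" "card (E - B) = r" using card_r B by auto
    show "card (B \<inter> H i) \<le> rs i" "card ((E - B) \<inter> H i) \<le> rs i" if "i \<in> {1..q}" for i
      using B that by (auto simp: basis_def J)
  qed (use H overlap BE in auto)
  obtain C C' where C: "split_partition C C' r {1..q} rs H" "C \<union> C' = B \<union> (E - B)"
    and card_C: "card (C \<inter> X) + 1 = card (B \<inter> X)"
    using descent[OF less] by blast
  interpret C: split_partition C C' r "{1..q}" rs H by (fact C(1))
  have "C \<subseteq> E" "E - C = C'" using C(2) C.disjoint_parts BE by auto
  moreover have "C \<in> J" "C' \<in> J"
    using C.bound C.bound' C.card_parts calculation by (auto simp: J)
  ultimately show ?thesis using basisI C.card_parts card_C by auto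
qed

text \<open>This lets the uniform components share the treatment of the non-uniform one.\<close>

lemma uniform_imp_elementary_split:
  assumes "uniform_matroid E J"
  shows "elementary_split_matroid E J"
proof -
  obtain k where "finite E" "k \<le> card E" "J = {X. X \<subseteq> E \<and> card X \<le> k}"
    using assms by (auto simp: uniform_matroid_def)
  then show ?thesis
    unfolding elementary_split_matroid_def
    by (intro conjI exI[of _ "0::nat"] exI[of _ k]) auto
qed

section \<open>Decomposition into connected components\<close>

context matroid
begin

lemma dependent_contains_circuit:
  assumes "X \<subseteq> S" "X \<notin> \<I>"
  obtains C where "circuit S \<I> C" "C \<subseteq> X"
proof -
  have "finite X" using assms(1) finite_ground finite_subset by blast
  then have "\<exists>C. circuit S \<I> C \<and> C \<subseteq> X" using assms
  proof (induction X rule: finite_psubset_induct)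
    case (psubset X)
    show ?case
    proof (cases "circuit S \<I> X")
      case False
      then obtain Y where "Y \<subset> X" "Y \<notin> \<I>" using psubset.prems by (auto simp: circuit_def)
      then show ?thesis using psubset.IH[of Y] psubset.prems by blast
    qed blast
  qed
  then show ?thesis using that by blast
qed

definition maximal_in :: "'a set \<Rightarrow> 'a set \<Rightarrow> bool" where
  "maximal_in A Y \<longleftrightarrow> Y \<in> \<I> \<and> Y \<subseteq> A \<and> (\<forall>a\<in>A - Y. insert a Y \<notin> \<I>)"

lemma extend_to_maximal:
  assumes "X \<in> \<I>" "X \<subseteq> A"
  obtains Y where "maximal_in A Y" "X \<subseteq> Y"
proof -
  define F where "F = {Y\<in>\<I>. X \<subseteq> Y \<and> Y \<subseteq> A}"
  have "finite F"
    by (rule finite_subset[of _ "Pow S"]) (use finite_ground indep_subset_ground in \<open>auto simp: F_def\<close>)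
  moreover have "F \<noteq> {}" using assms by (auto simp: F_def)
  ultimately obtain Y where Y: "Y \<in> F" and max: "\<forall>Z\<in>F. Y \<subseteq> Z \<longrightarrow> Y = Z"
    using finite_has_maximal[of F] by metis
  have "insert a Y \<notin> \<I>" if "a \<in> A - Y" for a
    using bspec[OF max, of "insert a Y"] Y that by (auto simp: F_def)
  then show ?thesis using that[of Y] Y by (auto simp: maximal_in_def F_def)
qed

lemma card_maximal_le:
  assumes "maximal_in A Y" "Z \<in> \<I>" "Z \<subseteq> A"
  shows "card Z \<le> card Y"
proof (rule ccontr)
  assume "\<not> ?thesis"
  then obtain z where "z \<in> Z - Y" "insert z Y \<in> \<I>"
    using augment[of Y Z] assms by (auto simp: maximal_in_def)
  then show False using assms by (auto simp: maximal_in_def)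
qed

text \<open>
  In other words, a maximal independent subset of \<open>A\<close> spans every element that is spanned by \<open>A\<close>.
  Otherwise \<open>insert g Y\<close> would be larger than a maximal independent subset \<open>Z\<close> of \<open>A\<close> through
  \<open>C - {g}\<close>, yet no element of it can be added to \<open>Z\<close>.
\<close>

lemma circuit_closes:
  assumes Y: "maximal_in A Y" and C: "circuit S \<I> C" "g \<in> C" "C - {g} \<subseteq> A" and "g \<notin> Y"
  shows "insert g Y \<notin> \<I>"
proof
  assume gY: "insert g Y \<in> \<I>"
  have "C - {g} \<in> \<I>" using C by (auto simp: circuit_def)
  then obtain Z where Z: "maximal_in A Z" "C - {g} \<subseteq> Z"
    using extend_to_maximal C by blast
  have "finite Y" using Y indep_subset_ground finite_ground finite_subset
    by (metis maximal_in_def)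
  then have "card Z < card (insert g Y)"
    using card_maximal_le[OF Y, of Z] Z \<open>g \<notin> Y\<close> by (auto simp: maximal_in_def)
  then obtain y where y: "y \<in> insert g Y - Z" "insert y Z \<in> \<I>"
    using augment[of Z "insert g Y"] gY Z by (auto simp: maximal_in_def)
  show False
  proof (cases "y = g")
    case True
    then have "C \<in> \<I>" using indep_subset[OF y(2)] Z by blast
    then show False using C by (simp add: circuit_def)
  next
    case False
    then show False using y Y Z by (auto simp: maximal_in_def)
  qed
qed

text \<open>
  Let \<open>Y\<close> be a maximal independent subset of \<open>C1 \<union> C2\<close> without \<open>e\<close> and \<open>f\<close>. Because of \<open>C2\<close> it
  spans \<open>e\<close>, and then because of \<open>C1\<close> it spans \<open>f\<close>; the circuit this creates is the required one.
\<close>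

lemma strong_circuit_elimination:
  assumes C1: "circuit S \<I> C1" and C2: "circuit S \<I> C2"
    and e: "e \<in> C1 \<inter> C2" and f: "f \<in> C1 - C2"
  obtains C3 where "circuit S \<I> C3" "f \<in> C3" "C3 \<subseteq> C1 \<union> C2 - {e}"
proof -
  define A where "A = C1 \<union> C2 - {e, f}"
  obtain Y where Y: "maximal_in A Y" by (rule extend_to_maximal[OF empty_indep empty_subsetI])
  have eY: "e \<notin> Y" "f \<notin> Y" using Y by (auto simp: maximal_in_def A_def)
  have "insert e Y \<notin> \<I>"
    using circuit_closes[OF Y C2, of e] e f eY by (auto simp: A_def)
  then have "maximal_in (insert e A) Y" using Y by (auto simp: maximal_in_def)
  then have dep: "insert f Y \<notin> \<I>"
    using circuit_closes[OF _ C1, of "insert e A" Y f] f eY by (auto simp: A_def)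
  have "insert f Y \<subseteq> S"
    using Y C1 f indep_subset_ground by (auto simp: maximal_in_def circuit_def)
  then obtain C3 where C3: "circuit S \<I> C3" "C3 \<subseteq> insert f Y"
    using dep by (rule dependent_contains_circuit)
  have "f \<in> C3"
  proof (rule ccontr)
    assume "f \<notin> C3"
    then have "C3 \<in> \<I>" using C3 Y by (intro indep_subset[of Y C3]) (auto simp: maximal_in_def)
    then show False using C3 by (simp add: circuit_def)
  qed
  moreover have "C3 \<subseteq> C1 \<union> C2 - {e}" using C3 Y e f by (auto simp: maximal_in_def A_def)
  ultimately show ?thesis using that C3 by blast
qed

lemma circuit_not_subset: "circuit S \<I> C \<Longrightarrow> circuit S \<I> D \<Longrightarrow> C \<subseteq> D \<Longrightarrow> C = D"
  by (auto simp: circuit_def)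

text \<open>
  The transitivity of connectedness. In a counterexample with the smallest union, eliminate a common
  element \<open>e\<close> to get \<open>C3\<close> through \<open>x\<close> and \<open>C4\<close> through \<open>z\<close>. The first meets \<open>C2\<close>, so by minimality
  it contains \<open>C1 - C2\<close>, which \<open>C4\<close> meets. Then \<open>C3\<close> and \<open>C4\<close> are a counterexample avoiding \<open>e\<close>.
\<close>

lemma meeting_circuits_connected:
  assumes "circuit S \<I> C1" "circuit S \<I> C2" "x \<in> C1" "z \<in> C2" "C1 \<inter> C2 \<noteq> {}"
  shows "\<exists>C. circuit S \<I> C \<and> x \<in> C \<and> z \<in> C"
  using assms
proof (induction "card (C1 \<union> C2)" arbitrary: C1 C2 rule: less_induct)
  case less
  show ?case
  proof (rule ccontr)
    assume neg: "\<not> ?case"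
    then have x: "x \<in> C1 - C2" and z: "z \<in> C2 - C1" using less.prems by auto
    obtain e where e: "e \<in> C1 \<inter> C2" using less.prems by blast
    have fin: "finite (C1 \<union> C2)"
      using less.prems finite_ground by (auto simp: circuit_def intro: finite_subset)
    have covers: "C1 \<union> C2 \<subseteq> D1 \<union> D2"
      if "circuit S \<I> D1" "circuit S \<I> D2" "x \<in> D1" "z \<in> D2" "D1 \<inter> D2 \<noteq> {}" "D1 \<union> D2 \<subseteq> C1 \<union> C2"
      for D1 D2
      using less.hyps[of D1 D2] psubset_card_mono[OF fin, of "D1 \<union> D2"] that neg by blast
    obtain C3 where C3: "circuit S \<I> C3" "x \<in> C3" "C3 \<subseteq> C1 \<union> C2 - {e}"
      by (rule strong_circuit_elimination[OF less.prems(1,2) e x])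
    obtain C4 where C4: "circuit S \<I> C4" "z \<in> C4" "C4 \<subseteq> C2 \<union> C1 - {e}"
      by (rule strong_circuit_elimination[OF less.prems(2,1) _ z, of e]) (use e in blast)
    have "\<not> C3 \<subseteq> C1" "\<not> C4 \<subseteq> C2"
      using circuit_not_subset C3 C4 less.prems e by blast+
    then have meet: "C3 \<inter> C2 \<noteq> {}" "C4 \<inter> (C1 - C2) \<noteq> {}" using C3 C4 by blast+
    have "C1 \<union> C2 \<subseteq> C3 \<union> C2" using covers[of C3 C2] C3 less.prems meet by blast
    then have "C3 \<inter> C4 \<noteq> {}" using meet by blast
    then have "C1 \<union> C2 \<subseteq> C3 \<union> C4" using covers[of C3 C4] C3 C4 by blast
    then show False using C3 C4 e by blast
  qed
qed

lemma equiv_conn_rel: "equiv S (conn_rel S \<I>)"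
proof (rule equivI)
  show "conn_rel S \<I> \<subseteq> S \<times> S" "refl_on S (conn_rel S \<I>)" "sym (conn_rel S \<I>)"
    by (auto simp: conn_rel_def refl_on_def sym_def)
  show "trans (conn_rel S \<I>)"
  proof (rule transI)
    fix x y z assume xy: "(x, y) \<in> conn_rel S \<I>" and yz: "(y, z) \<in> conn_rel S \<I>"
    show "(x, z) \<in> conn_rel S \<I>"
    proof (cases "x = y \<or> y = z")
      case False
      then obtain C1 C2 where "circuit S \<I> C1" "x \<in> C1" "y \<in> C1" "circuit S \<I> C2" "y \<in> C2" "z \<in> C2"
        using xy yz by (auto simp: conn_rel_def)
      then show ?thesis
        using meeting_circuits_connected[of C1 C2 x z] xy yz by (auto simp: conn_rel_def)
    qed (use xy yz in auto)
  qed
qed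

lemma Union_components: "\<Union> (components S \<I>) = S"
  unfolding components_def by (rule Union_quotient[OF equiv_conn_rel])

lemma components_disjoint:
  "D \<in> components S \<I> \<Longrightarrow> D' \<in> components S \<I> \<Longrightarrow> D \<noteq> D' \<Longrightarrow> D \<inter> D' = {}"
  unfolding components_def using quotient_disj[OF equiv_conn_rel] by blast

lemma component_subset: "D \<in> components S \<I> \<Longrightarrow> D \<subseteq> S"
  using Union_upper[of D "components S \<I>"] unfolding Union_components .

lemma finite_components: "finite (components S \<I>)"
  using finite_ground by (intro finite_UnionD) (simp add: Union_components)

text \<open>A circuit lies within one component, so a dependent set is already dependent there.\<close>

lemma indep_iff_components:
  assumes "X \<subseteq> S"
  shows "X \<in> \<I> \<longleftrightarrow> (\<forall>D\<in>components S \<I>. X \<inter> D \<in> \<I>)"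
proof
  assume "X \<in> \<I>"
  then show "\<forall>D\<in>components S \<I>. X \<inter> D \<in> \<I>" using indep_subset by blast
next
  assume parts: "\<forall>D\<in>components S \<I>. X \<inter> D \<in> \<I>"
  show "X \<in> \<I>"
  proof (rule ccontr)
    assume "X \<notin> \<I>"
    obtain C where C: "circuit S \<I> C" "C \<subseteq> X"
      by (rule dependent_contains_circuit[OF assms \<open>X \<notin> \<I>\<close>])
    then have "C \<noteq> {}" using empty_indep unfolding circuit_def by metis
    then obtain x where x: "x \<in> C" by blast
    let ?D = "conn_rel S \<I> `` {x}"
    have "C \<subseteq> X \<inter> ?D" using C x assms by (auto simp: conn_rel_def)
    moreover have "?D \<in> components S \<I>"
      using x C assms by (auto simp: components_def intro: quotientI)
    ultimately have "C \<in> \<I>" using parts indep_subset by blast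
    then show False using C by (simp add: circuit_def)
  qed
qed

lemma basis_iff_components:
  assumes "B \<subseteq> S"
  shows "basis \<I> B \<longleftrightarrow> (\<forall>D\<in>components S \<I>. basis (restriction \<I> D) (B \<inter> D))"
proof
  assume B: "basis \<I> B"
  show "\<forall>D\<in>components S \<I>. basis (restriction \<I> D) (B \<inter> D)"
  proof
    fix D assume D: "D \<in> components S \<I>"
    have "Y = B \<inter> D" if Y: "Y \<in> \<I>" "Y \<subseteq> D" "B \<inter> D \<subseteq> Y" for Y
    proof -
      have "(B \<union> Y) \<inter> D' \<in> \<I>" if D': "D' \<in> components S \<I>" for D'
      proof (cases "D' = D")
        case True
        then show ?thesis using Y by (intro indep_subset[OF Y(1)]) blast
      next
        case False
        then have "(B \<union> Y) \<inter> D' \<subseteq> B" using components_disjoint[OF D D'] Y by blast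
        then show ?thesis using B indep_subset by (auto simp: basis_def)
      qed
      then have "B \<union> Y \<in> \<I>"
        using indep_iff_components[of "B \<union> Y"] assms indep_subset_ground[OF Y(1)] by blast
      then show ?thesis using B Y by (auto simp: basis_def)
    qed
    then show "basis (restriction \<I> D) (B \<inter> D)"
      using B indep_subset[of B "B \<inter> D"] by (auto simp: basis_def restriction_def)
  qed
next
  assume parts: "\<forall>D\<in>components S \<I>. basis (restriction \<I> D) (B \<inter> D)"
  have "B \<in> \<I>"
    using parts by (subst indep_iff_components[OF assms]) (auto simp: basis_def restriction_def)
  moreover have "Y = B" if Y: "Y \<in> \<I>" "B \<subseteq> Y" for Y
  proof -
    have "Y \<inter> D = B \<inter> D" if "D \<in> components S \<I>" for D
      using parts that Y indep_subset[OF Y(1), of "Y \<inter> D"]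
      by (auto simp: basis_def restriction_def)
    then have "Y \<inter> \<Union> (components S \<I>) = B \<inter> \<Union> (components S \<I>)" by blast
    then show ?thesis
      unfolding Union_components using assms indep_subset_ground[OF Y(1)] by blast
  qed
  ultimately show "basis \<I> B" by (auto simp: basis_def)
qed

lemma card_components_sum:
  assumes "A \<subseteq> S"
  shows "card A = (\<Sum>D\<in>components S \<I>. card (A \<inter> D))"
proof -
  have "A = A \<inter> \<Union> (components S \<I>)" unfolding Union_components using assms by blast
  also have "\<dots> = (\<Union>D\<in>components S \<I>. A \<inter> D)" by blast
  also have "card \<dots> = (\<Sum>D\<in>components S \<I>. card (A \<inter> D))"
  proof (rule card_UN_disjoint[OF finite_components])
    show "\<forall>D\<in>components S \<I>. finite (A \<inter> D)"
      using assms finite_ground by (auto intro: finite_subset)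
    show "\<forall>D\<in>components S \<I>. \<forall>D'\<in>components S \<I>. D \<noteq> D' \<longrightarrow> A \<inter> D \<inter> (A \<inter> D') = {}"
      using components_disjoint by blast
  qed
  finally show ?thesis .
qed

section \<open>Descent in split matroids\<close>

text \<open>Only the part of \<open>B\<close> within one component that shows an excess is replaced.\<close>

lemma descent_from_components:
  assumes es: "\<And>D. D \<in> components S \<I> \<Longrightarrow> elementary_split_matroid D (restriction \<I> D)"
    and B: "basis \<I> B" "basis \<I> (S - B)"
    and less: "card ((S - B) \<inter> X) < card (B \<inter> X)"
  shows "\<exists>C. basis \<I> C \<and> basis \<I> (S - C) \<and> card (C \<inter> X) + 1 = card (B \<inter> X)"
proof -
  have BS: "B \<subseteq> S" using B indep_subset_ground by (auto simp: basis_def)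
  have "\<exists>D\<in>components S \<I>. card ((S - B) \<inter> X \<inter> D) < card (B \<inter> X \<inter> D)"
  proof (rule ccontr)
    assume "\<not> ?thesis"
    then have "(\<Sum>D\<in>components S \<I>. card (B \<inter> X \<inter> D))
        \<le> (\<Sum>D\<in>components S \<I>. card ((S - B) \<inter> X \<inter> D))"
      by (intro sum_mono) (auto simp: not_less)
    moreover have "B \<inter> X \<subseteq> S" "(S - B) \<inter> X \<subseteq> S" using BS by auto
    ultimately show False
      using less card_components_sum[of "B \<inter> X"] card_components_sum[of "(S - B) \<inter> X"] by linarith
  qed
  then obtain D where D: "D \<in> components S \<I>"
    and less_D: "card ((S - B) \<inter> X \<inter> D) < card (B \<inter> X \<inter> D)" by blast
  have DS: "D \<subseteq> S" using D by (rule component_subset)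
  have eqs: "(S - B) \<inter> D = D - B \<inter> D" "(S - B) \<inter> X \<inter> D = (D - B \<inter> D) \<inter> X"
    "B \<inter> X \<inter> D = (B \<inter> D) \<inter> X" using DS by auto
  have B_D: "basis (restriction \<I> D) (B \<inter> D)" "basis (restriction \<I> D) (D - B \<inter> D)"
    using basis_iff_components[OF BS] basis_iff_components[of "S - B"] B D eqs by auto
  obtain C where C: "C \<subseteq> D" "basis (restriction \<I> D) C" "basis (restriction \<I> D) (D - C)"
    and card_C: "card (C \<inter> X) + 1 = card (B \<inter> D \<inter> X)"
    using elementary_split_descent[OF es[OF D] B_D] less_D unfolding eqs by blast
  define B2 where "B2 = (B - D) \<union> C"
  have B2S: "B2 \<subseteq> S" using BS C DS by (auto simp: B2_def)
  have local: "B2 \<inter> D' = (if D' = D then C else B \<inter> D') \<and>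
      (S - B2) \<inter> D' = (if D' = D then D - C else (S - B) \<inter> D')" if "D' \<in> components S \<I>" for D'
    using components_disjoint[OF D that] C DS by (auto simp: B2_def)
  have "basis \<I> B2" "basis \<I> (S - B2)"
    using basis_iff_components[OF BS] basis_iff_components[of "S - B"] B C local
      basis_iff_components[OF B2S] basis_iff_components[of "S - B2"] by auto
  moreover have "card (B2 \<inter> X) + 1 = card (B \<inter> X)"
  proof -
    have finB: "finite B" using finite_subset[OF BS finite_ground] .
    have "B2 \<inter> X = (B \<inter> X - D) \<union> (C \<inter> X)" by (auto simp: B2_def)
    moreover have "card ((B \<inter> X - D) \<union> (C \<inter> X)) = card (B \<inter> X - D) + card (C \<inter> X)"
      using finB finite_subset[OF C(1)] finite_subset[OF DS finite_ground] C(1)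
      by (intro card_Un_disjoint) auto
    moreover have "card (B \<inter> X) = card (B \<inter> X \<inter> D) + card (B \<inter> X - D)"
      using finB by (intro card_Int_Diff) auto
    ultimately show ?thesis using card_C eqs by simp
  qed
  ultimately show ?thesis by blast
qed

lemma balanced_bases_from_components:
  assumes es: "\<And>D. D \<in> components S \<I> \<Longrightarrow> elementary_split_matroid D (restriction \<I> D)"
    and B: "basis \<I> B" "basis \<I> (S - B)"
    and le: "card ((S - B) \<inter> X) \<le> card (B \<inter> X)"
    and X: "X \<subseteq> S"
  shows "\<exists>C. basis \<I> C \<and> basis \<I> (S - C) \<and>
    card ((S - C) \<inter> X) \<le> card (C \<inter> X) \<and> card (C \<inter> X) \<le> card ((S - C) \<inter> X) + 1"
  using B le
proof (induction "card (B \<inter> X)" arbitrary: B rule: less_induct)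
  case less
  show ?case
  proof (cases "card (B \<inter> X) \<le> card ((S - B) \<inter> X) + 1")
    case False
    then obtain C where C: "basis \<I> C" "basis \<I> (S - C)" "card (C \<inter> X) + 1 = card (B \<inter> X)"
      using descent_from_components[OF es less.prems(1,2), of X] by auto
    have total: "card (D \<inter> X) + card ((S - D) \<inter> X) = card X" for D
    proof -
      have "card X = card (X \<inter> D) + card (X - D)"
        using finite_subset[OF X finite_ground] by (rule card_Int_Diff)
      moreover have "X - D = (S - D) \<inter> X" using X by blast
      ultimately show ?thesis by (simp add: Int_commute)
    qed
    have "card ((S - C) \<inter> X) \<le> card (C \<inter> X)"
      using total[of B] total[of C] C(3) False by linarith
    then show ?thesis using less.hyps[of C] C by auto
  qed (use less.prems in blast)
qed

end

lemma split_matroid_components: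
  assumes "split_matroid S \<I>" "D \<in> components S \<I>"
  shows "elementary_split_matroid D (restriction \<I> D)"
  using assms uniform_imp_elementary_split by (auto simp: split_matroid_def)

theorem corollary16:
  fixes S :: "'a set" and \<I> :: "'a set set"
  assumes "split_matroid S \<I>"
    and "\<exists>B\<^sub>1 B\<^sub>2. basis \<I> B\<^sub>1 \<and> basis \<I> B\<^sub>2 \<and> B\<^sub>1 \<inter> B\<^sub>2 = {} \<and> B\<^sub>1 \<union> B\<^sub>2 = S"
  shows "equitable_matroid S \<I>"
  unfolding equitable_matroid_def
proof (intro allI impI)
  fix X assume X: "X \<subseteq> S"
  interpret matroid S \<I> using assms(1) by (simp add: split_matroid_def)
  obtain B1 B2 where B12: "basis \<I> B1" "basis \<I> B2" "B1 \<inter> B2 = {}" "B1 \<union> B2 = S"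
    using assms(2) by blast
  then have "S - B1 = B2" "S - B2 = B1" by auto
  then obtain B where B: "basis \<I> B" "basis \<I> (S - B)" "card ((S - B) \<inter> X) \<le> card (B \<inter> X)"
    using B12 by (metis nat_le_linear)
  obtain C where C: "basis \<I> C" "basis \<I> (S - C)"
    "card ((S - C) \<inter> X) \<le> card (C \<inter> X)" "card (C \<inter> X) \<le> card ((S - C) \<inter> X) + 1"
    using balanced_bases_from_components[OF split_matroid_components[OF assms(1)] B X] by blast
  have "card X = card (X \<inter> C) + card (X - C)"
    using finite_subset[OF X finite_ground] by (rule card_Int_Diff)
  moreover have "X - C = (S - C) \<inter> X" using X by blast
  ultimately have "card X = card (C \<inter> X) + card ((S - C) \<inter> X)" by (simp add: Int_commute)
  then have "\<lfloor>real (card X) / 2\<rfloor> \<le> int (card (C \<inter> X))" "int (card (C \<inter> X)) \<le> \<lceil>real (card X) / 2\<rceil>"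
    using C(3,4) by linarith+
  then show "\<exists>B. basis \<I> B \<and> basis \<I> (S - B) \<and>
      \<lfloor>real (card X) / 2\<rfloor> \<le> int (card (B \<inter> X)) \<and> int (card (B \<inter> X)) \<le> \<lceil>real (card X) / 2\<rceil>"
    using C(1,2) by blast
qed

end
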